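(* Let $F_1$ and $F_2$ be two cumulative distribution functions of continuous random variables with probability density functions, and let $\lambda\in[-1,1]$. Let $\prec_{\rm order}$ be any one of the orders $\prec_{\rm c}$, $\prec_{*}$, $\prec_{\rm su}$, $\prec_{\rm disp}$. Then $$F_1\prec_{\rm order}F_2\ \Longrightarrow\ G_\lambda[F_1]\prec_{\rm order}G_\lambda[F_2].$$
   Context: For a univariate cumulative distribution function (cdf) $F$ and $\lambda\in[-1,1]$, write $\bar F=1-F$ and define the cdf $G_\lambda[F]$ by $G_{\lambda}[F](x)=F(x)\{1+\lambda\bar F(x)\}$ for all $x\in\mathbb{R}$. The quantile function of a cdf $F$ is $F^{-1}(u)=\sup\{x\mid F(x)\leq u\}$, $0\leq u\leq 1$. Write $F_2^{-1}F_1(x)=F_2^{-1}(F_1(x))$. Orders between cdfs $F_1$ and $F_2$: convex transform order, $F_1\prec_{\rm c}F_2$ if $F_2^{-1}F_1(x)$ is convex in $x$ on the support of $F_1$; star order, $F_1\prec_{*}F_2$ if $F_2^{-1}F_1(x)/x$ is increasing in $x>0$; superadditive order, $F_1\prec_{\rm su}F_2$ if $F_2^{-1}F_1(x+y)\geq F_2^{-1}F_1(x)+F_2^{-1}F_1(y)$ for all $x,y\ge 0$; dispersive order, $F_1\prec_{\rm disp}F_2$ if $F_2^{-1}F_1(x)-x$ is increasing in $x$. Increasing is meant in the non-strict sense. *)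

theory Defs
  imports "HOL-Probability.Probability"
begin

definition G :: "real \<Rightarrow> (real \<Rightarrow> real) \<Rightarrow> real \<Rightarrow> real" where
  "G lam F x = F x * (1 + lam * (1 - F x))"

(* The supremum is taken in the extended reals: it is always \<infinity> for u = 1, and it is
   -\<infinity> for u = 0 when F is positive everywhere. *)
definition quantile :: "(real \<Rightarrow> real) \<Rightarrow> real \<Rightarrow> ereal" where
  "quantile F u = (SUP x \<in> {x. F x \<le> u}. ereal x)"

(* The topological support of the probability measure with cdf F. *)
definition cdf_support :: "(real \<Rightarrow> real) \<Rightarrow> real set" where
  "cdf_support F = {x. \<forall>e>0. F (x - e) < F (x + e)}"

(* The library's convex_on is for real-valued functions only. In ereal, \<infinity> + (-\<infinity>) = \<infinity> and
   0 * \<infinity> = 0. When S is an interval, the condition that the combination lies in S is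
   automatic; a support need not be an interval. *)
definition ereal_convex_on :: "real set \<Rightarrow> (real \<Rightarrow> ereal) \<Rightarrow> bool" where
  "ereal_convex_on S f \<longleftrightarrow>
    (\<forall>x\<in>S. \<forall>y\<in>S. \<forall>t\<in>{0..1}. (1 - t) * x + t * y \<in> S \<longrightarrow>
      f ((1 - t) * x + t * y) \<le> ereal (1 - t) * f x + ereal t * f y)"

definition convex_transform_order :: "(real \<Rightarrow> real) \<Rightarrow> (real \<Rightarrow> real) \<Rightarrow> bool" where
  "convex_transform_order F1 F2 \<longleftrightarrow>
    ereal_convex_on (cdf_support F1) (\<lambda>x. quantile F2 (F1 x))"

(* The star, superadditive and dispersive orders are not restricted to the support of F1:
   the range of the arguments is all x > 0, all x, y >= 0 and all real x, respectively. *)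
definition star_order :: "(real \<Rightarrow> real) \<Rightarrow> (real \<Rightarrow> real) \<Rightarrow> bool" where
  "star_order F1 F2 \<longleftrightarrow> mono_on {0<..} (\<lambda>x. quantile F2 (F1 x) / ereal x)"

definition superadditive_order :: "(real \<Rightarrow> real) \<Rightarrow> (real \<Rightarrow> real) \<Rightarrow> bool" where
  "superadditive_order F1 F2 \<longleftrightarrow>
    (\<forall>x\<ge>0. \<forall>y\<ge>0. quantile F2 (F1 (x + y)) \<ge> quantile F2 (F1 x) + quantile F2 (F1 y))"

definition dispersive_order :: "(real \<Rightarrow> real) \<Rightarrow> (real \<Rightarrow> real) \<Rightarrow> bool" where
  "dispersive_order F1 F2 \<longleftrightarrow> mono (\<lambda>x. quantile F2 (F1 x) - ereal x)"

end

(* On [0,1] the map p \<mapsto> p * (1 + lam * (1 - p)) is strictly increasing, so G lam F2 x \<le> G lam F1 y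
   holds exactly when F2 x \<le> F1 y does. Hence the transform changes neither the function
   F2^{-1} F1 nor the support of F1, and each of the orders depends on these data only. *)
theory Submission
  imports Defs
begin

text \<open>The difference of the two values factors as \<open>q - p\<close> times
  \<open>1 + lam * (1 - (p + q))\<close>, so its sign is that of \<open>q - p\<close> once the
  second factor is positive. Two functions are allowed because the quantile compares values of
  \<open>F1\<close> and \<open>F2\<close>.\<close>

lemma G_less_iff:
  assumes "lam \<in> {-1..1}" and "F x \<in> {0..1}" and "H y \<in> {0..1}"
  shows "G lam F x < G lam H y \<longleftrightarrow> F x < H y"
proof -
  define p q where "p = F x" and "q = H y"
  have pq: "p \<in> {0..1}" "q \<in> {0..1}"
    using assms by (auto simp: p_def q_def)
  have diff: "G lam H y - G lam F x = (q - p) * (1 + lam * (1 - (p + q)))"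
    by (simp add: G_def p_def q_def algebra_simps)
  \<comment> \<open>Without \<open>p \<noteq> q\<close> the factor can vanish: at
    \<open>p = q = 0\<close> for \<open>lam = -1\<close> and at \<open>p = q = 1\<close> for
    \<open>lam = 1\<close>. Distinct points of [0,1] have a sum strictly between 0 and 2.\<close>
  have pos: "0 < 1 + lam * (1 - (p + q))" if "p \<noteq> q"
  proof -
    have "\<bar>lam * (1 - (p + q))\<bar> \<le> \<bar>1 - (p + q)\<bar>"
      using assms(1) mult_right_mono[of "\<bar>lam\<bar>" 1 "\<bar>1 - (p + q)\<bar>"] by (auto simp: abs_mult)
    moreover have "\<bar>1 - (p + q)\<bar> < 1"
      using pq that by auto
    ultimately show ?thesis by linarith
  qed
  have "0 < G lam H y - G lam F x \<longleftrightarrow> 0 < q - p"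
    unfolding diff using pos by (cases "p = q") (auto simp: zero_less_mult_iff)
  then show ?thesis by (simp add: p_def q_def)
qed

text \<open>Both suprema range over the same sublevel set, so infinite values agree as well.\<close>

lemma quantile_G:
  assumes "lam \<in> {-1..1}" and "range F \<subseteq> {0..1}" and "range H \<subseteq> {0..1}"
  shows "quantile (G lam H) (G lam F x) = quantile H (F x)"
proof -
  have "G lam H z \<le> G lam F x \<longleftrightarrow> H z \<le> F x" for z
    using G_less_iff[OF assms(1), of F x H z] assms(2,3)
    by (simp add: image_subset_iff flip: not_less)
  then show ?thesis by (simp add: quantile_def)
qed

lemma cdf_support_G:
  assumes "lam \<in> {-1..1}" and "range F \<subseteq> {0..1}"
  shows "cdf_support (G lam F) = cdf_support F"
proof -
  have "G lam F x < G lam F y \<longleftrightarrow> F x < F y" for x y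
    using assms by (intro G_less_iff) (simp_all add: image_subset_iff)
  then show ?thesis by (simp add: cdf_support_def)
qed

lemma range_cdf_distr:
  assumes "prob_space M" and "X \<in> borel_measurable M"
  shows "range (cdf (distr M borel X)) \<subseteq> {0..1}"
proof -
  interpret real_distribution "distr M borel X"
    using assms by (intro prob_space.real_distribution_distr) auto
  show ?thesis by (auto intro: cdf_nonneg cdf_bounded_prob)
qed

theorem proposition4:
  fixes M1 :: "'a measure" and M2 :: "'b measure"
    and X1 :: "'a \<Rightarrow> real" and X2 :: "'b \<Rightarrow> real"
    and f1 f2 :: "real \<Rightarrow> ennreal"
    and F1 F2 :: "real \<Rightarrow> real"
    and lam :: real
    and R :: "(real \<Rightarrow> real) \<Rightarrow> (real \<Rightarrow> real) \<Rightarrow> bool"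
  assumes "prob_space M1" and "distributed M1 lborel X1 f1" and "F1 = cdf (distr M1 borel X1)"
    and "prob_space M2" and "distributed M2 lborel X2 f2" and "F2 = cdf (distr M2 borel X2)"
    and "lam \<in> {-1..1}"
    and "R \<in> {convex_transform_order, star_order, superadditive_order, dispersive_order}"
    and "R F1 F2"
  shows "R (G lam F1) (G lam F2)"
proof -
  have "range F1 \<subseteq> {0..1}" "range F2 \<subseteq> {0..1}"
    using range_cdf_distr assms(1-6) distributed_measurable by (metis measurable_lborel1)+
  then have q: "quantile (G lam F2) (G lam F1 x) = quantile F2 (F1 x)"
    and s: "cdf_support (G lam F1) = cdf_support F1" for x
    using assms(7) by (simp_all add: quantile_G cdf_support_G)
  \<comment> \<open>After rewriting with \<open>q\<close>, both sides coincide for each order;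
    \<open>s\<close> serves the convex transform order, the one restricted to the support.\<close>
  have "R (G lam F1) (G lam F2) = R F1 F2"
    using assms(8) by (auto simp: q s convex_transform_order_def star_order_def
        superadditive_order_def dispersive_order_def)
  with assms(9) show ?thesis by simp
qed

end
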